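(* Let $\mathbb{K}$ be an algebraically closed field, $V$ a $\mathbb{K}$-vector space of finite positive dimension, and $\Phi=(A;\{E_i\}_{i=0}^d;A^*;\{E_i^*\}_{i=0}^d)$ a TD system on $V$ of diameter $d\geq 1$ that has $q$-Racah type, with fixed associated scalars $q,a,b$. Let $K,B\in\mathrm{End}(V)$ and the subspaces $W_i$ be as defined in the context. Then for $0\leq i\leq d$, $$(K-q^{d-2i}I)W_i\subseteq W_{i-1},\qquad\qquad (B-q^{d-2i}I)W_i\subseteq W_{i-1}.$$
   Context: TD pair: an ordered pair of linear maps $A,A^*:V\to V$ such that (i) each is diagonalizable; (ii) there is an ordering $\{V_i\}_{i=0}^d$ of the eigenspaces of $A$ with $A^*V_i\subseteq V_{i-1}+V_i+V_{i+1}$ for $0\le i\le d$ ($V_{-1}=V_{d+1}=0$); (iii) there is an ordering $\{V_i^*\}_{i=0}^\delta$ of the eigenspaces of $A^*$ with $AV_i^*\subseteq V_{i-1}^*+V_i^*+V_{i+1}^*$ for $0\le i\le\delta$ ($V^*_{-1}=V^*_{\delta+1}=0$); (iv) no subspace $W$ with $0\ne W\ne V$ satisfies $AW\subseteq W$ and $A^*W\subseteq W$. It is known that $d=\delta$; $d$ is called the diameter. Orderings as in (ii), (iii) are called standard. The primitive idempotent of $A$ for an eigenspace $V_i$ is the projection of $V$ onto $V_i$ that vanishes on the other eigenspaces (similarly for $A^*$). TD system: $(A;\{E_i\}_{i=0}^d;A^*;\{E_i^*\}_{i=0}^d)$ where $A,A^*$ is a TD pair and $\{E_i\}$, $\{E_i^*\}$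 are the primitive idempotents of $A$, $A^*$, in orders for which the corresponding eigenspace orderings $\{E_iV\}$, $\{E_i^*V\}$ are standard. Let $\theta_i$ (resp. $\theta_i^*$) be the eigenvalue of $A$ on $E_iV$ (resp. of $A^*$ on $E_i^*V$). $\Phi$ has $q$-Racah type if there are nonzero $q,a,b\in\mathbb{K}$ with $q^4\ne1$ and $\theta_i=aq^{d-2i}+a^{-1}q^{2i-d}$, $\theta_i^*=bq^{d-2i}+b^{-1}q^{2i-d}$ for $0\le i\le d$. (Distinctness of eigenvalues forces $q^{2i}\neq1$ for $1\le i\le d$, and $a^2\ne q^{2d-2},q^{2d-4},\dots,q^{2-2d}$; in particular $a^2\neq 1$.) Split decompositions: $U_i=(E_0^*V+\cdots+E_i^*V)\cap(E_iV+\cdots+E_dV)$ and $U_i^\Downarrow=(E_0^*V+\cdots+E_i^*V)\cap(E_0V+\cdots+E_{d-i}V)$ for $0\le i\le d$. It is known that $V=\bigoplus_i U_i=\bigoplus_i U_i^\Downarrow$ with all summands nonzero. $K,B\in\mathrm{End}(V)$ are the linear maps acting on $U_i$, respectively $U_i^\Downarrow$, as the scalar $q^{d-2i}$ ($0\le i\le d$). $\mathcal{M}=\dfrac{aK-a^{-1}B}{a-a^{-1}}\in\mathrm{End}(V)$, and $W_i=\{v\in V:\mathcal{M}v=q^{d-2i}v\}$ is the eigenspace of $\mathcal{M}$ for the eigenvalue $q^{d-2i}$ ($0\le i\le d$); $W_{-1}=0$, $W_{d+1}=0$. *)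

theory Defs
  imports
    "HOL-Computational_Algebra.Polynomial"
    "HOL-Library.Set_Algebras"
begin

text \<open>
  Vector spaces are given by a scalar multiplication \<open>scale\<close> as in the locale
  \<open>vector_space\<close>. Sums of subspaces are the elementwise sums of sets from
  \<open>Set_Algebras\<close>; the zero subspace \<open>{0}\<close> is the neutral element.
\<close>

definition eigenspace :: "('k::field \<Rightarrow> 'v::ab_group_add \<Rightarrow> 'v) \<Rightarrow> ('v \<Rightarrow> 'v) \<Rightarrow> 'k \<Rightarrow> 'v set" where
  "eigenspace scale A \<theta> = {v. A v = scale \<theta> v}"

definition eigenspaces :: "('k::field \<Rightarrow> 'v::ab_group_add \<Rightarrow> 'v) \<Rightarrow> ('v \<Rightarrow> 'v) \<Rightarrow> 'v set set" where
  "eigenspaces scale A = {W. W \<noteq> {0} \<and> (\<exists>\<theta>. W = eigenspace scale A \<theta>)}"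

definition diagonalizable :: "('k::field \<Rightarrow> 'v::ab_group_add \<Rightarrow> 'v) \<Rightarrow> ('v \<Rightarrow> 'v) \<Rightarrow> bool" where
  "diagonalizable scale A \<longleftrightarrow> module.span scale (\<Union>(eigenspaces scale A)) = UNIV"

text \<open>The convention \<open>V\<^sub>-\<^sub>1 = V\<^sub>d\<^sub>+\<^sub>1 = 0\<close> for a family \<open>V\<^sub>0, \<dots>, V\<^sub>d\<close>.\<close>

definition zero_ext :: "nat \<Rightarrow> (nat \<Rightarrow> 'v::zero set) \<Rightarrow> int \<Rightarrow> 'v set" where
  "zero_ext d V j = (if 0 \<le> j \<and> j \<le> int d then V (nat j) else {0})"

text \<open>\<open>V\<^sub>0, \<dots>, V\<^sub>d\<close> is an ordering of the eigenspaces of \<open>A\<close> (without repetition) on which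
  \<open>A'\<close> acts in a block tridiagonal way.\<close>

definition standard_ordering ::
  "('k::field \<Rightarrow> 'v::ab_group_add \<Rightarrow> 'v) \<Rightarrow> ('v \<Rightarrow> 'v) \<Rightarrow> ('v \<Rightarrow> 'v) \<Rightarrow> nat \<Rightarrow> (nat \<Rightarrow> 'v set) \<Rightarrow> bool" where
  "standard_ordering scale A A' d V \<longleftrightarrow>
     bij_betw V {0..d} (eigenspaces scale A) \<and>
     (\<forall>i\<le>d. A' ` V i \<subseteq> zero_ext d V (int i - 1) + V i + zero_ext d V (int i + 1))"

definition TD_pair ::
  "('k::field \<Rightarrow> 'v::ab_group_add \<Rightarrow> 'v) \<Rightarrow> ('v \<Rightarrow> 'v) \<Rightarrow> ('v \<Rightarrow> 'v) \<Rightarrow> bool" where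
  "TD_pair scale A As \<longleftrightarrow>
     Vector_Spaces.linear scale scale A \<and> Vector_Spaces.linear scale scale As \<and>
     diagonalizable scale A \<and> diagonalizable scale As \<and>
     (\<exists>d V. standard_ordering scale A As d V) \<and>
     (\<exists>\<delta> Vs. standard_ordering scale As A \<delta> Vs) \<and>
     \<not> (\<exists>W. module.subspace scale W \<and> W \<noteq> {0} \<and> W \<noteq> UNIV \<and> A ` W \<subseteq> W \<and> As ` W \<subseteq> W)"

definition primitive_idempotent ::
  "('k::field \<Rightarrow> 'v::ab_group_add \<Rightarrow> 'v) \<Rightarrow> ('v \<Rightarrow> 'v) \<Rightarrow> 'v set \<Rightarrow> ('v \<Rightarrow> 'v) \<Rightarrow> bool" where
  "primitive_idempotent scale A W E \<longleftrightarrow>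
     W \<in> eigenspaces scale A \<and> Vector_Spaces.linear scale scale E \<and>
     range E = W \<and> (\<forall>w\<in>W. E w = w) \<and>
     (\<forall>W'\<in>eigenspaces scale A. W' \<noteq> W \<longrightarrow> (\<forall>w\<in>W'. E w = 0))"

definition TD_system ::
  "('k::field \<Rightarrow> 'v::ab_group_add \<Rightarrow> 'v) \<Rightarrow> nat \<Rightarrow> ('v \<Rightarrow> 'v) \<Rightarrow> (nat \<Rightarrow> 'v \<Rightarrow> 'v) \<Rightarrow>
     ('v \<Rightarrow> 'v) \<Rightarrow> (nat \<Rightarrow> 'v \<Rightarrow> 'v) \<Rightarrow> bool" where
  "TD_system scale d A E As Es \<longleftrightarrow>
     TD_pair scale A As \<and>
     (\<forall>i\<le>d. primitive_idempotent scale A (range (E i)) (E i)) \<and>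
     (\<forall>i\<le>d. primitive_idempotent scale As (range (Es i)) (Es i)) \<and>
     standard_ordering scale A As d (\<lambda>i. range (E i)) \<and>
     standard_ordering scale As A d (\<lambda>i. range (Es i))"

text \<open>The eigenvalue of \<open>A\<close> on \<open>W\<close>; well defined if \<open>W\<close> is a nonzero eigenspace of \<open>A\<close>.\<close>

definition eigenvalue_on ::
  "('k::field \<Rightarrow> 'v::ab_group_add \<Rightarrow> 'v) \<Rightarrow> ('v \<Rightarrow> 'v) \<Rightarrow> 'v set \<Rightarrow> 'k" where
  "eigenvalue_on scale A W = (THE \<theta>. \<forall>w\<in>W. A w = scale \<theta> w)"

definition q_Racah_type ::
  "('k::field \<Rightarrow> 'v::ab_group_add \<Rightarrow> 'v) \<Rightarrow> nat \<Rightarrow> ('v \<Rightarrow> 'v) \<Rightarrow> (nat \<Rightarrow> 'v \<Rightarrow> 'v) \<Rightarrow>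
     ('v \<Rightarrow> 'v) \<Rightarrow> (nat \<Rightarrow> 'v \<Rightarrow> 'v) \<Rightarrow> 'k \<Rightarrow> 'k \<Rightarrow> 'k \<Rightarrow> bool" where
  "q_Racah_type scale d A E As Es q a b \<longleftrightarrow>
     q \<noteq> 0 \<and> a \<noteq> 0 \<and> b \<noteq> 0 \<and> q ^ 4 \<noteq> 1 \<and>
     (\<forall>i\<le>d. eigenvalue_on scale A (range (E i)) =
              a * q powi (int d - 2 * int i) + inverse a * q powi (2 * int i - int d)) \<and>
     (\<forall>i\<le>d. eigenvalue_on scale As (range (Es i)) =
              b * q powi (int d - 2 * int i) + inverse b * q powi (2 * int i - int d))"

definition split_U :: "nat \<Rightarrow> (nat \<Rightarrow> 'v \<Rightarrow> 'v::ab_group_add) \<Rightarrow> (nat \<Rightarrow> 'v \<Rightarrow> 'v) \<Rightarrow> nat \<Rightarrow> 'v set" where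
  "split_U d E Es i = (\<Sum>h\<in>{0..i}. range (Es h)) \<inter> (\<Sum>h\<in>{i..d}. range (E h))"

definition split_U_down :: "nat \<Rightarrow> (nat \<Rightarrow> 'v \<Rightarrow> 'v::ab_group_add) \<Rightarrow> (nat \<Rightarrow> 'v \<Rightarrow> 'v) \<Rightarrow> nat \<Rightarrow> 'v set" where
  "split_U_down d E Es i = (\<Sum>h\<in>{0..i}. range (Es h)) \<inter> (\<Sum>h\<in>{0..d-i}. range (E h))"

text \<open>The linear map \<open>X\<close> acts on \<open>U i\<close> as \<open>q\<^sup>d\<^sup>-\<^sup>2\<^sup>i\<close>. This determines \<open>X\<close> uniquely if the space
  is the sum of \<open>U 0, \<dots>, U d\<close>, as is the case for both split decompositions.\<close>

definition weight_map ::
  "('k::field \<Rightarrow> 'v::ab_group_add \<Rightarrow> 'v) \<Rightarrow> 'k \<Rightarrow> nat \<Rightarrow> (nat \<Rightarrow> 'v set) \<Rightarrow> ('v \<Rightarrow> 'v) \<Rightarrow> bool" where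
  "weight_map scale q d U X \<longleftrightarrow>
     Vector_Spaces.linear scale scale X \<and>
     (\<forall>i\<le>d. \<forall>u\<in>U i. X u = scale (q powi (int d - 2 * int i)) u)"

definition M_map ::
  "('k::field \<Rightarrow> 'v::ab_group_add \<Rightarrow> 'v) \<Rightarrow> 'k \<Rightarrow> ('v \<Rightarrow> 'v) \<Rightarrow> ('v \<Rightarrow> 'v) \<Rightarrow> 'v \<Rightarrow> 'v" where
  "M_map scale a K B v =
     scale (inverse (a - inverse a)) (scale a (K v) - scale (inverse a) (B v))"

definition W_space ::
  "('k::field \<Rightarrow> 'v::ab_group_add \<Rightarrow> 'v) \<Rightarrow> nat \<Rightarrow> 'k \<Rightarrow> 'k \<Rightarrow> ('v \<Rightarrow> 'v) \<Rightarrow> ('v \<Rightarrow> 'v) \<Rightarrow> int \<Rightarrow> 'v set" where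
  "W_space scale d q a K B =
     zero_ext d (\<lambda>i. eigenspace scale (M_map scale a K B) (q powi (int d - 2 * int i)))"

end

theory Submission
  imports Defs
begin

text \<open>
  Put \<open>Q = q\<^sup>2\<close>. Since \<open>K\<close> and \<open>B\<close> scale the split decompositions, which \<open>A\<close> raises and
  \<open>A*\<close> lowers up to eigenvalues, they satisfy the \<open>q\<close>-Weyl type relations
  \<open>Q K A - A K = (Q - 1) (a K\<^sup>2 + a\<^sup>-\<^sup>1)\<close> and \<open>Q A* K - K A* = (Q - 1) (b K\<^sup>2 + b\<^sup>-\<^sup>1)\<close>,
  and similarly for \<open>B\<close> with \<open>a\<close> inverted in the first one. The claim amounts to
  \<open>Q K M - M K = (Q - 1) M\<^sup>2\<close>, which up to a scalar says that a certain quadratic expression \<open>X\<close>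
  in \<open>K\<close> and \<open>B\<close> vanishes. By the Weyl relations, \<open>X A - Q\<^sup>-\<^sup>2 A X\<close> and
  \<open>A* X - Q\<^sup>-\<^sup>2 X A*\<close> are combinations of \<open>X K, X B, K X, B X\<close>. Hence the largest subspace of the
  kernel of \<open>X\<close> that is invariant under \<open>K\<close> and \<open>B\<close> is also invariant under \<open>A\<close> and \<open>A*\<close>.
  It contains \<open>E\<^sub>0* V\<close>, so it is \<open>V\<close> by irreducibility, and \<open>X = 0\<close>.

  For \<open>i = 0\<close> this only gives \<open>(K - q\<^sup>d) W\<^sub>0 \<subseteq> ker (M - q\<^sup>d\<^sup>+\<^sup>2)\<close>, which can be nonzero when
  \<open>q\<^sup>2\<^sup>d\<^sup>+\<^sup>2 = 1\<close>. Instead, \<open>M\<close> is triangular on the flag \<open>E\<^sub>0* V + \<dots> + E\<^sub>i* V\<close> with distinct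
  diagonal scalars, so \<open>W\<^sub>0 \<subseteq> E\<^sub>0* V\<close>, where \<open>K\<close> acts as \<open>q\<^sup>d\<close>.
\<close>

subsection \<open>Linear algebra\<close>

context vector_space
begin

text \<open>Coordinates with respect to a basis separate vectors. This turns identities between
  vectors into identities between scalars, to which \<open>algebra\<close> and
  \<open>field_simps\<close> apply.\<close>

lemma eq_if_linear_functionals_eq:
  assumes "\<And>f. \<lbrakk>\<And>u v. f (u + v) = f u + f v; \<And>u v. f (u - v) = f u - f v; \<And>c v. f (scale c v) = c * f v\<rbrakk>
    \<Longrightarrow> f x = f y"
  shows "x = y"
proof -
  define S where "S = extend_basis {}"
  have S: "independent S" "span S = UNIV"
    using independent_extend_basis span_extend_basis independent_empty unfolding S_def by blast+
  have "representation S x b = representation S y b" for b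
    by (rule assms[where f = "\<lambda>v. representation S v b"])
      (simp_all add: S representation_add representation_diff representation_scale)
  then have "representation S (x - y) b = 0" for b
    by (simp add: S representation_diff)
  then show ?thesis
    using sum_nonzero_representation_eq[of S "x - y"] by (simp add: S)
qed

lemma linear_image_span_subset:
  assumes "Vector_Spaces.linear scale scale f" "subspace T" "\<And>x. x \<in> S \<Longrightarrow> f x \<in> T" "x \<in> span S"
  shows "f x \<in> T"
proof -
  interpret f: Vector_Spaces.linear scale scale f by fact
  have "f ` span S \<subseteq> T"
    using assms(2,3) by (metis f.span_image image_subsetI span_minimal)
  then show ?thesis using assms(4) by blast
qed

lemma linear_shift:
  assumes "Vector_Spaces.linear scale scale f"
  shows "Vector_Spaces.linear scale scale (\<lambda>v. f v - scale c v)"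
proof -
  interpret f: Vector_Spaces.linear scale scale f by fact
  show ?thesis
    by unfold_locales (simp_all add: f.add f.scale algebra_simps)
qed

lemma subspace_equalizer:
  assumes "Vector_Spaces.linear scale scale f" "Vector_Spaces.linear scale scale g"
  shows "subspace {v. f v = g v}"
proof -
  interpret f: Vector_Spaces.linear scale scale f by fact
  interpret g: Vector_Spaces.linear scale scale g by fact
  show ?thesis
    by (rule subspaceI) (simp_all add: f.add g.add f.scale g.scale f.zero g.zero)
qed

lemma set_sum_eq_span:
  assumes "finite H" "\<And>h. h \<in> H \<Longrightarrow> subspace (S h)"
  shows "(\<Sum>h\<in>H. S h) = span (\<Union>h\<in>H. S h)"
  using assms
proof (induction H)
  case empty
  then show ?case by (simp add: set_zero)
next
  case (insert h H)
  have "span (S h) = S h" using insert.prems by (simp add: span_eq_iff)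
  moreover have "(\<Sum>h\<in>H. S h) = span (\<Union>h\<in>H. S h)" using insert by blast
  ultimately show ?case
    using insert.hyps by (auto simp: span_Un set_plus_def; metis)
qed

lemma subspace_set_plus_least:
  assumes "subspace T" "S1 \<subseteq> T" "S2 \<subseteq> T"
  shows "S1 + S2 \<subseteq> T"
  using assms by (auto simp: set_plus_def intro!: subspace_add)

end

subsection \<open>The quadratic relation between the two weight maps\<close>

text \<open>Exchanging \<open>a\<close> and \<open>inverse a\<close> turns the relation of
  \<open>A\<close> with \<open>K\<close> into the one with \<open>B\<close>, whereas
  \<open>As\<close> satisfies the same relation with both. The scalar \<open>b'\<close> will be
  \<open>inverse b\<close>.\<close>

locale q_weyl_relations =
  vector_space scale +
  A: Vector_Spaces.linear scale scale A + As: Vector_Spaces.linear scale scale As +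
  K: Vector_Spaces.linear scale scale K + B: Vector_Spaces.linear scale scale B
  for scale :: "'k::field \<Rightarrow> 'v::ab_group_add \<Rightarrow> 'v"
    and A As K B :: "'v \<Rightarrow> 'v" +
  fixes Q a b b' :: 'k
  assumes Q_nz: "Q \<noteq> 0" and a_nz: "a \<noteq> 0" and a_square: "a\<^sup>2 \<noteq> 1"
    and K_A: "scale Q (K (A v)) = A (K v) + scale (Q - 1) (scale a (K (K v)) + scale (inverse a) v)"
    and B_A: "scale Q (B (A v)) = A (B v) + scale (Q - 1) (scale (inverse a) (B (B v)) + scale a v)"
    and As_K: "scale Q (As (K v)) = K (As v) + scale (Q - 1) (scale b (K (K v)) + scale b' v)"
    and As_B: "scale Q (As (B v)) = B (As v) + scale (Q - 1) (scale b (B (B v)) + scale b' v)"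
begin

text \<open>\<open>X = (a\<^sup>2 - 1)\<^sup>2 ((Q - 1) M\<^sup>2 - (Q K M - M K))\<close> for \<open>M = (a K - a\<^sup>-\<^sup>1 B) / (a - a\<^sup>-\<^sup>1)\<close>.\<close>

definition X :: "'v \<Rightarrow> 'v" where
  "X v = scale (a\<^sup>2 * (Q - 1)) (K (K v)) - scale (Q - a\<^sup>2) (K (B v))
     - scale (a\<^sup>2 * Q - 1) (B (K v)) + scale (Q - 1) (B (B v))"

lemmas hom_simps = A.add A.scale A.diff As.add As.scale As.diff K.add K.scale K.diff B.add B.scale B.diff

lemma linear_X: "Vector_Spaces.linear scale scale X"
  by unfold_locales (simp_all add: X_def hom_simps algebra_simps)

text \<open>Each quadratic word in \<open>K\<close> and \<open>B\<close> is moved past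
  \<open>A\<close> by using the relations twice. The coefficients of \<open>X\<close> make the
  linear terms cancel, and the remaining cubic terms recombine into products of \<open>X\<close>
  with \<open>K\<close> or \<open>B\<close> on either side. The factor \<open>a\<^sup>2 - 1\<close>
  clears denominators.\<close>

lemma X_A:
  "scale ((a\<^sup>2 - 1) * Q\<^sup>2) (X (A v)) = scale (a\<^sup>2 - 1) (A (X v)) +
     scale ((Q - 1) * a) (scale (a\<^sup>2 * Q - 1) (X (K v)) + scale ((a\<^sup>2 - Q) * (inverse a)\<^sup>2) (X (B v))
       + scale (a\<^sup>2 - Q) (K (X v)) + scale ((a\<^sup>2 * Q - 1) * (inverse a)\<^sup>2) (B (X v)))"
proof (rule eq_if_linear_functionals_eq, goal_cases)
  case (1 f)
  have KK: "Q\<^sup>2 * f (K (K (A v))) = f (A (K (K v))) + (Q\<^sup>2 - 1) * (a * f (K (K (K v))) + inverse a * f (K v))"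
    using arg_cong[OF K_A[of "K v"], of f] arg_cong[OF K_A[of v], of "\<lambda>v. f (K v)"]
    by (simp add: 1 hom_simps) algebra
  have BB: "Q\<^sup>2 * f (B (B (A v))) = f (A (B (B v))) + (Q\<^sup>2 - 1) * (inverse a * f (B (B (B v))) + a * f (B v))"
    using arg_cong[OF B_A[of "B v"], of f] arg_cong[OF B_A[of v], of "\<lambda>v. f (B v)"]
    by (simp add: 1 hom_simps) algebra
  have KB: "Q\<^sup>2 * f (K (B (A v))) = f (A (K (B v))) + (Q - 1) * (a * f (K (K (B v))) + inverse a * f (B v))
      + Q * (Q - 1) * (inverse a * f (K (B (B v))) + a * f (K v))"
    using arg_cong[OF K_A[of "B v"], of f] arg_cong[OF B_A[of v], of "\<lambda>v. f (K v)"]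
    by (simp add: 1 hom_simps) algebra
  have BK: "Q\<^sup>2 * f (B (K (A v))) = f (A (B (K v))) + (Q - 1) * (inverse a * f (B (B (K v))) + a * f (K v))
      + Q * (Q - 1) * (a * f (B (K (K v))) + inverse a * f (B v))"
    using arg_cong[OF B_A[of "K v"], of f] arg_cong[OF K_A[of v], of "\<lambda>v. f (B v)"]
    by (simp add: 1 hom_simps) algebra
  have "Q\<^sup>2 * f (X (A v)) = a\<^sup>2 * (Q - 1) * (Q\<^sup>2 * f (K (K (A v)))) - (Q - a\<^sup>2) * (Q\<^sup>2 * f (K (B (A v))))
      - (a\<^sup>2 * Q - 1) * (Q\<^sup>2 * f (B (K (A v)))) + (Q - 1) * (Q\<^sup>2 * f (B (B (A v))))"
    by (simp add: 1 X_def algebra_simps)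
  note X_A_eq = this[unfolded KK BB KB BK]
  have "(a\<^sup>2 - 1) * (Q\<^sup>2 * f (X (A v))) = (a\<^sup>2 - 1) * f (A (X v)) +
     (Q - 1) * a * ((a\<^sup>2 * Q - 1) * f (X (K v)) + (a\<^sup>2 - Q) * (inverse a)\<^sup>2 * f (X (B v))
       + (a\<^sup>2 - Q) * f (K (X v)) + (a\<^sup>2 * Q - 1) * (inverse a)\<^sup>2 * f (B (X v)))"
    unfolding X_A_eq using a_nz by (simp add: 1 X_def hom_simps field_simps power2_eq_square)
  then show ?case
    by (simp add: 1 mult_ac)
qed

text \<open>The words pass \<open>As\<close> in the opposite direction, so the factor
  \<open>Q\<^sup>2\<close> now belongs to \<open>As (X v)\<close>. Again the linear terms
  cancel.\<close>

lemma X_As: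
  "scale (a\<^sup>2 - 1) (X (As v)) = scale ((a\<^sup>2 - 1) * Q\<^sup>2) (As (X v)) -
     scale ((Q - 1) * b) (scale (a\<^sup>2 * Q - 1) (X (K v)) + scale (a\<^sup>2 - Q) (X (B v))
       + scale (a\<^sup>2 - Q) (K (X v)) + scale (a\<^sup>2 * Q - 1) (B (X v)))"
proof (rule eq_if_linear_functionals_eq, goal_cases)
  case (1 f)
  have KK: "Q\<^sup>2 * f (As (K (K v))) = f (K (K (As v))) + (Q\<^sup>2 - 1) * (b * f (K (K (K v))) + b' * f (K v))"
    using arg_cong[OF As_K[of "K v"], of f] arg_cong[OF As_K[of v], of "\<lambda>v. f (K v)"]
    by (simp add: 1 hom_simps) algebra
  have BB: "Q\<^sup>2 * f (As (B (B v))) = f (B (B (As v))) + (Q\<^sup>2 - 1) * (b * f (B (B (B v))) + b' * f (B v))"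
    using arg_cong[OF As_B[of "B v"], of f] arg_cong[OF As_B[of v], of "\<lambda>v. f (B v)"]
    by (simp add: 1 hom_simps) algebra
  have KB: "Q\<^sup>2 * f (As (K (B v))) = f (K (B (As v))) + (Q - 1) * (b * f (K (B (B v))) + b' * f (K v))
      + Q * (Q - 1) * (b * f (K (K (B v))) + b' * f (B v))"
    using arg_cong[OF As_K[of "B v"], of f] arg_cong[OF As_B[of v], of "\<lambda>v. f (K v)"]
    by (simp add: 1 hom_simps) algebra
  have BK: "Q\<^sup>2 * f (As (B (K v))) = f (B (K (As v))) + (Q - 1) * (b * f (B (K (K v))) + b' * f (B v))
      + Q * (Q - 1) * (b * f (B (B (K v))) + b' * f (K v))"
    using arg_cong[OF As_B[of "K v"], of f] arg_cong[OF As_K[of v], of "\<lambda>v. f (B v)"]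
    by (simp add: 1 hom_simps) algebra
  have eq: "Q\<^sup>2 * f (As (X v)) = a\<^sup>2 * (Q - 1) * (Q\<^sup>2 * f (As (K (K v)))) - (Q - a\<^sup>2) * (Q\<^sup>2 * f (As (K (B v))))
      - (a\<^sup>2 * Q - 1) * (Q\<^sup>2 * f (As (B (K v)))) + (Q - 1) * (Q\<^sup>2 * f (As (B (B v))))"
    by (simp add: 1 X_def hom_simps algebra_simps)
  have "(a\<^sup>2 - 1) * f (X (As v)) = (a\<^sup>2 - 1) * (Q\<^sup>2 * f (As (X v))) -
     (Q - 1) * b * ((a\<^sup>2 * Q - 1) * f (X (K v)) + (a\<^sup>2 - Q) * f (X (B v))
       + (a\<^sup>2 - Q) * f (K (X v)) + (a\<^sup>2 * Q - 1) * f (B (X v)))"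
    unfolding eq[unfolded KK BB KB BK] by (simp add: 1 X_def hom_simps algebra_simps power2_eq_square)
  then show ?case
    by (simp add: 1 mult_ac)
qed

theorem X_eq_0:
  assumes irreducible: "\<And>W. \<lbrakk>subspace W; A ` W \<subseteq> W; As ` W \<subseteq> W\<rbrakk> \<Longrightarrow> W = {0} \<or> W = UNIV"
    and Y: "subspace Y" "Y \<noteq> {0}" "K ` Y \<subseteq> Y" "B ` Y \<subseteq> Y" "\<And>y. y \<in> Y \<Longrightarrow> X y = 0"
  shows "X v = 0"
proof -
  define good where
    "good S \<longleftrightarrow> subspace S \<and> K ` S \<subseteq> S \<and> B ` S \<subseteq> S \<and> (\<forall>y\<in>S. X y = 0)" for S
  \<comment> \<open>A span of good subspaces is good again, so \<open>Z\<close> is the largest good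
    subspace.\<close>
  define Z where "Z = span (\<Union>{S. good S})"
  have good_span: "good (span S)"
    if "\<And>x. x \<in> S \<Longrightarrow> K x \<in> span S \<and> B x \<in> span S \<and> X x = 0" for S
  proof -
    have "X x \<in> {0}" if "x \<in> span S" for x
      by (rule linear_image_span_subset[OF linear_X _ _ that])
        (use \<open>\<And>x. x \<in> S \<Longrightarrow> _\<close> in auto)
    moreover have "K x \<in> span S" "B x \<in> span S" if "x \<in> span S" for x
      using linear_image_span_subset[OF K.linear_axioms subspace_span _ that]
        linear_image_span_subset[OF B.linear_axioms subspace_span _ that]
        \<open>\<And>x. x \<in> S \<Longrightarrow> _\<close> by blast+
    ultimately show ?thesis
      unfolding good_def by (auto intro: subspace_span)
  qed
  have "good Z"
    unfolding Z_def by (rule good_span) (unfold good_def; blast intro: span_base)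
  have Z_max: "S \<subseteq> Z" if "good S" for S
    using that unfolding Z_def by (auto intro: span_base)
  have Z: "subspace Z" "K z \<in> Z" "B z \<in> Z" "X z = 0" if "z \<in> Z" for z
    using \<open>good Z\<close> that unfolding good_def by auto
  \<comment> \<open>Under these conditions the sum of \<open>Z\<close> and its image under
    \<open>T\<close> is good, so maximality of \<open>Z\<close> forces the image into
    \<open>Z\<close>.\<close>
  have extend: "T ` Z \<subseteq> Z"
    if "\<And>z. z \<in> Z \<Longrightarrow> K (T z) \<in> span (Z \<union> T ` Z) \<and> B (T z) \<in> span (Z \<union> T ` Z) \<and> X (T z) = 0" for T
  proof -
    have "good (span (Z \<union> T ` Z))"
      by (rule good_span) (use that Z in \<open>auto intro: span_base\<close>)
    then show ?thesis
      using Z_max by (meson Un_upper2 span_superset subset_trans)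
  qed
  have "A ` Z \<subseteq> Z"
  proof (rule extend)
    fix z assume z: "z \<in> Z"
    have "scale Q (K (A z)) \<in> span (Z \<union> A ` Z)" "scale Q (B (A z)) \<in> span (Z \<union> A ` Z)"
      unfolding K_A B_A using z Z by (intro span_add span_scale; auto intro: span_base)+
    then have "K (A z) \<in> span (Z \<union> A ` Z)" "B (A z) \<in> span (Z \<union> A ` Z)"
      using Q_nz span_scale[of _ _ "inverse Q"] by fastforce+
    \<comment> \<open>Since \<open>X\<close> vanishes at \<open>z\<close>, \<open>K z\<close> and
      \<open>B z\<close>, the exchange formula leaves only a nonzero multiple of
      \<open>X (A z)\<close>.\<close>
    moreover have "X (A z) = 0"
      using X_A[of z] z Z Q_nz a_square by (simp add: A.zero K.zero B.zero)
    ultimately show "K (A z) \<in> span (Z \<union> A ` Z) \<and> B (A z) \<in> span (Z \<union> A ` Z) \<and> X (A z) = 0"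
      by blast
  qed
  moreover have "As ` Z \<subseteq> Z"
  proof (rule extend)
    fix z assume z: "z \<in> Z"
    have "K (As z) = scale Q (As (K z)) - scale (Q - 1) (scale b (K (K z)) + scale b' z)"
      "B (As z) = scale Q (As (B z)) - scale (Q - 1) (scale b (B (B z)) + scale b' z)"
      unfolding As_K As_B by simp_all
    moreover have "scale Q (As (K z)) - scale (Q - 1) (scale b (K (K z)) + scale b' z) \<in> span (Z \<union> As ` Z)"
      "scale Q (As (B z)) - scale (Q - 1) (scale b (B (B z)) + scale b' z) \<in> span (Z \<union> As ` Z)"
      using z Z by (intro span_diff span_add span_scale; auto intro: span_base)+
    moreover have "X (As z) = 0"
      using X_As[of z] z Z a_square by (simp add: As.zero K.zero B.zero)
    ultimately show "K (As z) \<in> span (Z \<union> As ` Z) \<and> B (As z) \<in> span (Z \<union> As ` Z) \<and> X (As z) = 0"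
      by simp
  qed
  moreover have "good Y"
    using Y unfolding good_def by blast
  then have "Z \<noteq> {0}"
    using Z_max[of Y] Y subspace_0[OF Y(1)] by blast
  moreover have "subspace Z"
    using \<open>good Z\<close> good_def by blast
  ultimately have "Z = UNIV"
    using irreducible by blast
  then show ?thesis
    using Z by blast
qed

text \<open>Up to sign the two sides differ by \<open>X v\<close> divided by the square of
  \<open>a\<^sup>2 - 1\<close>. The relation makes \<open>K - m\<close> send an eigenvector of
  \<open>M\<close> for \<open>m\<close> to zero or to an eigenvector for \<open>Q m\<close>.\<close>

lemma M_map_q_commutation:
  assumes "X v = 0"
  shows "scale Q (K (M_map scale a K B v)) - M_map scale a K B (K v)
    = scale (Q - 1) (M_map scale a K B (M_map scale a K B v))"
proof (rule eq_if_linear_functionals_eq, goal_cases)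
  case (1 f)
  have "f (X v) = 0"
    using assms 1(3)[of 0 0] by simp
  then have "a\<^sup>2 * (Q - 1) * f (K (K v)) - (Q - a\<^sup>2) * f (K (B v)) - (a\<^sup>2 * Q - 1) * f (B (K v))
      + (Q - 1) * f (B (B v)) = 0"
    unfolding X_def 1 by (simp add: algebra_simps)
  moreover have "inverse (a - inverse a) = a / (a\<^sup>2 - 1)"
    using a_nz a_square by (simp add: field_simps power2_eq_square)
  moreover have "a\<^sup>2 - 1 \<noteq> 0"
    using a_square by simp
  ultimately show ?case
    using a_nz unfolding M_map_def
    by (simp add: 1 hom_simps divide_simps) algebra
qed

end

subsection \<open>Split decompositions\<close>

text \<open>\<open>F i\<close> and \<open>G i\<close> stand for \<open>E\<^sub>0* V + \<dots> + E\<^sub>i* V\<close> and \<open>E\<^sub>i V + \<dots> + E\<^sub>d V\<close>, or the latter with the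
  eigenspaces of \<open>A\<close> in reverse order for the second split decomposition. They are indexed by
  all integers so that the boundary cases need no separate treatment.\<close>

locale split_flags = vector_space scale
  for scale :: "'k::field \<Rightarrow> 'v::ab_group_add \<Rightarrow> 'v" +
  fixes A As :: "'v \<Rightarrow> 'v" and d :: nat and F G :: "int \<Rightarrow> 'v set" and \<theta> \<theta>s :: "int \<Rightarrow> 'k"
  assumes linear_A: "Vector_Spaces.linear scale scale A"
    and linear_As: "Vector_Spaces.linear scale scale As"
    and irreducible: "\<And>W. \<lbrakk>subspace W; A ` W \<subseteq> W; As ` W \<subseteq> W\<rbrakk> \<Longrightarrow> W = {0} \<or> W = UNIV"
    and subspace_F: "\<And>i. subspace (F i)" and subspace_G: "\<And>i. subspace (G i)"
    and F_mono: "\<And>i j. i \<le> j \<Longrightarrow> F i \<subseteq> F j"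
    and G_antimono: "\<And>i j. i \<le> j \<Longrightarrow> G j \<subseteq> G i"
    and F_neg: "\<And>i. i < 0 \<Longrightarrow> F i = {0}" and F_zero: "F 0 \<noteq> {0}"
    and F_top: "F (int d) = UNIV" and F_below_top: "F (int d - 1) \<noteq> UNIV"
    and G_beyond: "\<And>i. i > int d \<Longrightarrow> G i = {0}" and G_zero: "G 0 = UNIV"
    and A_F: "\<And>i v. v \<in> F i \<Longrightarrow> A v \<in> F (i + 1)"
    and As_F: "\<And>i v. v \<in> F i \<Longrightarrow> As v - scale (\<theta>s i) v \<in> F (i - 1)"
    and A_G: "\<And>i v. v \<in> G i \<Longrightarrow> A v - scale (\<theta> i) v \<in> G (i + 1)"
    and As_G: "\<And>i v. v \<in> G i \<Longrightarrow> As v \<in> G (i - 1)"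
begin

definition U :: "int \<Rightarrow> 'v set" where
  "U i = F i \<inter> G i"

text \<open>Subtracting the eigenvalue moves one step along \<open>G\<close>, while \<open>A\<close>
  moves at most one step along \<open>F\<close>, so the offset \<open>r\<close> between the two
  indices is preserved.\<close>

lemma A_shifted:
  assumes "v \<in> F (i - r) \<inter> G i"
  shows "A v - scale (\<theta> i) v \<in> F (i + 1 - r) \<inter> G (i + 1)"
proof -
  have "A v \<in> F (i + 1 - r)" "v \<in> F (i + 1 - r)"
    using A_F[of v "i - r"] F_mono[of "i - r" "i + 1 - r"] assms by (auto simp: algebra_simps)
  then show ?thesis
    using assms A_G by (auto intro: subspace_diff subspace_scale subspace_F)
qed

lemma As_shifted:
  assumes "v \<in> F (i - r) \<inter> G i"
  shows "As v - scale (\<theta>s (i - r)) v \<in> F (i - 1 - r) \<inter> G (i - 1)"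
proof -
  have "As v \<in> G (i - 1)" "v \<in> G (i - 1)"
    using As_G[of v i] G_antimono[of "i - 1" i] assms by auto
  moreover have "As v - scale (\<theta>s (i - r)) v \<in> F (i - 1 - r)"
    using As_F[of v "i - r"] assms by (auto simp: algebra_simps)
  ultimately show ?thesis
    by (auto intro: subspace_diff subspace_scale subspace_G)
qed

lemma A_U: "u \<in> U i \<Longrightarrow> A u - scale (\<theta> i) u \<in> U (i + 1)"
  using A_shifted[of u i 0] by (simp add: U_def)

lemma As_U: "u \<in> U i \<Longrightarrow> As u - scale (\<theta>s i) u \<in> U (i - 1)"
  using As_shifted[of u i 0] by (simp add: U_def)

text \<open>The shift \<open>r = 0\<close> shows that the \<open>U i\<close> span the space, \<open>r = 1\<close> that their sum is direct.\<close>

lemma span_shifted_trivial: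
  "span (\<Union>i. F (i - r) \<inter> G i) = {0} \<or> span (\<Union>i. F (i - r) \<inter> G i) = UNIV"
proof (rule irreducible)
  let ?W = "span (\<Union>i. F (i - r) \<inter> G i)"
  have *: "T v \<in> ?W" if "v \<in> F (i - r) \<inter> G i" "T v - scale c v \<in> F (j - r) \<inter> G j" for T c v i j
  proof -
    have "v \<in> ?W" "T v - scale c v \<in> ?W"
      by (rule span_base, use that in blast)+
    then have "(T v - scale c v) + scale c v \<in> ?W"
      by (blast intro: span_add span_scale)
    then show ?thesis by simp
  qed
  show "A ` ?W \<subseteq> ?W"
  proof safe
    fix x assume x: "x \<in> ?W"
    show "A x \<in> ?W"
      by (rule linear_image_span_subset[OF linear_A subspace_span _ x]) (use A_shifted * in blast)
  qed
  show "As ` ?W \<subseteq> ?W"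
  proof safe
    fix x assume x: "x \<in> ?W"
    show "As x \<in> ?W"
      by (rule linear_image_span_subset[OF linear_As subspace_span _ x]) (use As_shifted * in blast)
  qed
qed (rule subspace_span)

text \<open>The span contains \<open>U 0\<close>, which is the nonzero space \<open>F 0\<close>
  because \<open>G 0\<close> is everything. Irreducibility does the rest.\<close>

lemma span_U: "span (\<Union>i. U i) = UNIV"
proof -
  have "F 0 \<subseteq> span (\<Union>i. U i)"
    unfolding U_def using G_zero by (auto intro!: span_base)
  then have "span (\<Union>i. U i) \<noteq> {0}"
    using F_zero subspace_0[OF subspace_F[of 0]] by auto
  then show ?thesis
    using span_shifted_trivial[of 0] by (simp add: U_def)
qed

text \<open>All the intersections with offset one lie in the proper subspace
  \<open>F (d - 1)\<close>: for \<open>j \<le> d\<close> by monotonicity of \<open>F\<close>, and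
  for larger \<open>j\<close> because \<open>G j\<close> is zero. So their span is not the whole
  space and must be zero.\<close>

lemma F_inter_G: "F i \<inter> G (i + 1) = {0}"
proof -
  have "F (j - 1) \<inter> G j \<subseteq> F (int d - 1)" for j
    using F_mono[of "j - 1" "int d - 1"] G_beyond[of j] subspace_0[OF subspace_F] by force
  then have "span (\<Union>j. F (j - 1) \<inter> G j) \<subseteq> F (int d - 1)"
    by (intro span_minimal subspace_F) blast
  then have "span (\<Union>j. F (j - 1) \<inter> G j) = {0}"
    using span_shifted_trivial[of 1] F_below_top by blast
  moreover have "F i \<inter> G (i + 1) \<subseteq> span (\<Union>j. F (j - 1) \<inter> G j)"
    using span_superset[of "\<Union>j. F (j - 1) \<inter> G j"] by (force simp: subset_iff)
  ultimately show ?thesis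
    using subspace_0[OF subspace_F] subspace_0[OF subspace_G] by blast
qed

lemma U_outside: "i < 0 \<or> i > int d \<Longrightarrow> U i = {0}"
  using F_neg[of i] G_beyond[of i] subspace_0[OF subspace_F] subspace_0[OF subspace_G] by (auto simp: U_def)

lemma U_subset_F: "j \<le> i \<Longrightarrow> U j \<subseteq> F i"
  using F_mono by (auto simp: U_def)

text \<open>A vector of \<open>F i\<close> is written as a sum of components in the
  \<open>U j\<close>, and those with index above \<open>i\<close> are removed from the top down.
  Each of them lies in some \<open>F n \<inter> G (n + 1)\<close> and is therefore zero.\<close>

lemma F_eq_span_U: "F i = span (\<Union>j\<in>{..i}. U j)"
proof
  let ?S = "\<lambda>i. span (\<Union>j\<in>{..i}. U j)"
  show "?S i \<subseteq> F i" for i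
    by (rule span_minimal[OF _ subspace_F]) (use U_subset_F in auto)
  have descend: "F i \<inter> ?S n \<subseteq> ?S i" if "i \<le> n" for n
    using that
  proof (induction n rule: int_ge_induct)
    case (step n)
    show ?case
    proof
      fix x assume x: "x \<in> F i \<inter> ?S (n + 1)"
      have "{..n + 1} = insert (n + 1) {..n}" by auto
      then have "x \<in> span (U (n + 1) \<union> (\<Union>j\<in>{..n}. U j))"
        using x by simp
      then obtain u y where x_eq: "x = u + y" and "u \<in> span (U (n + 1))" and y: "y \<in> ?S n"
        unfolding span_Un by blast
      then have u: "u \<in> U (n + 1)"
        by (metis U_def span_eq_iff subspace_F subspace_G subspace_inter)
      have "y \<in> F n"
        using y U_subset_F span_minimal[OF _ subspace_F[of n], of "\<Union>j\<in>{..n}. U j"] by blast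
      then have "x - y \<in> F n"
        using x F_mono[OF step(1)] by (intro subspace_diff subspace_F) auto
      then have "u \<in> F n \<inter> G (n + 1)"
        using u x_eq by (simp add: U_def)
      then have "u = 0"
        using F_inter_G by blast
      then show "x \<in> ?S i"
        using x x_eq y step by auto
    qed
  qed auto
  \<comment> \<open>The descent starts at an index above every nonzero \<open>U j\<close>; the
    maximum also covers \<open>i > d\<close>.\<close>
  have "\<Union>(range U) \<subseteq> ?S (max i (int d))"
  proof safe
    fix x j assume "x \<in> U j"
    then show "x \<in> ?S (max i (int d))"
      using U_outside[of j] span_zero by (cases "j \<le> int d") (force intro: span_base)+
  qed
  then have "?S (max i (int d)) = UNIV"
    using span_U span_minimal[OF _ subspace_span] by blast
  then show "F i \<subseteq> ?S i"
    using descend[of "max i (int d)"] by auto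
qed

end

section \<open>Maps acting on a split decomposition with weights in geometric progression\<close>

locale split_weight_map =
  split_flags scale A As d F G \<theta> \<theta>s + K: Vector_Spaces.linear scale scale K
  for scale :: "'k::field \<Rightarrow> 'v::ab_group_add \<Rightarrow> 'v" and A As d F G \<theta> \<theta>s K +
  fixes \<mu> :: "int \<Rightarrow> 'k" and Q :: 'k
  assumes K_U: "\<And>i u. u \<in> U i \<Longrightarrow> K u = scale (\<mu> i) u"
    and weight_step: "\<And>i. Q * \<mu> (i + 1) = \<mu> i"
begin

text \<open>On \<open>U i\<close> the difference vanishes, and the \<open>U j\<close> with
  \<open>j < i\<close> already lie in \<open>F (i - 1)\<close>. Thus \<open>K\<close> is triangular
  on the flag \<open>F\<close>.\<close>

lemma weight_lowers_F:
  assumes "x \<in> F i"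
  shows "K x - scale (\<mu> i) x \<in> F (i - 1)"
proof (rule linear_image_span_subset[OF linear_shift[OF K.linear_axioms] subspace_F])
  show "x \<in> span (\<Union>j\<in>{..i}. U j)"
    using assms F_eq_span_U by blast
  fix u assume "u \<in> (\<Union>j\<in>{..i}. U j)"
  then obtain j where j: "j \<le> i" "u \<in> U j" by blast
  show "K u - scale (\<mu> i) u \<in> F (i - 1)"
  proof (cases "j = i")
    case True
    then show ?thesis using j K_U subspace_0[OF subspace_F] by simp
  next
    case False
    then have "u \<in> F (i - 1)" using j U_subset_F[of j "i - 1"] by auto
    then show ?thesis
      using K_U[OF j(2)] by (auto intro: subspace_diff subspace_scale subspace_F)
  qed
qed

text \<open>It suffices to check \<open>u\<close> in \<open>U i\<close>, where \<open>A u\<close> is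
  \<open>\<theta> i\<close> times \<open>u\<close> plus some \<open>u'\<close> in
  \<open>U (i + 1)\<close>. The coefficients of \<open>u'\<close> agree because
  \<open>Q * \<mu> (i + 1) = \<mu> i\<close>, and those of \<open>u\<close> by the assumed quadratic
  identity.\<close>

lemma weight_relation_A:
  assumes "\<And>i. \<theta> i * \<mu> i = c * (\<mu> i)\<^sup>2 + c'"
  shows "scale Q (K (A v)) = A (K v) + scale (Q - 1) (scale c (K (K v)) + scale c' v)"
proof -
  interpret A: Vector_Spaces.linear scale scale A by (rule linear_A)
  let ?f = "\<lambda>v. scale Q (K (A v))" and ?g = "\<lambda>v. A (K v) + scale (Q - 1) (scale c (K (K v)) + scale c' v)"
  have "subspace {v. ?f v = ?g v}"
    by (rule subspace_equalizer; unfold_locales)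
      (simp_all add: A.add A.scale K.add K.scale algebra_simps)
  moreover have "(\<Union>i. U i) \<subseteq> {v. ?f v = ?g v}"
  proof safe
    fix i u assume u: "u \<in> U i"
    define u' where "u' = A u - scale (\<theta> i) u"
    have Ku': "K u' = scale (\<mu> (i + 1)) u'"
      using A_U[OF u] K_U unfolding u'_def by blast
    have Au: "A u = scale (\<theta> i) u + u'"
      by (simp add: u'_def)
    have coeff: "Q * (\<theta> i * \<mu> i) = \<theta> i * \<mu> i + (Q - 1) * (c * (\<mu> i)\<^sup>2 + c')"
      using assms[of i] by (simp add: algebra_simps)
    have "?f u = scale (Q * (\<theta> i * \<mu> i)) u + scale (\<mu> i) u'"
      using weight_step[of i] by (simp add: Au K.add K.scale Ku' K_U[OF u] scale_right_distrib)
    also have "\<dots> = ?g u"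
      unfolding coeff
      by (simp add: K_U[OF u] A.scale K.scale Au scale_right_distrib scale_left_distrib power2_eq_square algebra_simps)
    finally show "?f u = ?g u" .
  qed
  ultimately have "span (\<Union>i. U i) \<subseteq> {v. ?f v = ?g v}"
    by (rule span_minimal[rotated])
  then show ?thesis
    using span_U by blast
qed

text \<open>Here \<open>u'\<close> lies in \<open>U (i - 1)\<close>, whose weight is
  \<open>Q * \<mu> i\<close>. This is why \<open>Q\<close> multiplies the product with
  \<open>K\<close> applied first.\<close>

lemma weight_relation_As:
  assumes "\<And>i. \<theta>s i * \<mu> i = c * (\<mu> i)\<^sup>2 + c'"
  shows "scale Q (As (K v)) = K (As v) + scale (Q - 1) (scale c (K (K v)) + scale c' v)"
proof -
  interpret As: Vector_Spaces.linear scale scale As by (rule linear_As)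
  let ?f = "\<lambda>v. scale Q (As (K v))" and ?g = "\<lambda>v. K (As v) + scale (Q - 1) (scale c (K (K v)) + scale c' v)"
  have "subspace {v. ?f v = ?g v}"
    by (rule subspace_equalizer; unfold_locales)
      (simp_all add: As.add As.scale K.add K.scale algebra_simps)
  moreover have "(\<Union>i. U i) \<subseteq> {v. ?f v = ?g v}"
  proof safe
    fix i u assume u: "u \<in> U i"
    define u' where "u' = As u - scale (\<theta>s i) u"
    have Ku': "K u' = scale (\<mu> (i - 1)) u'"
      using As_U[OF u] K_U unfolding u'_def by blast
    have Asu: "As u = scale (\<theta>s i) u + u'"
      by (simp add: u'_def)
    have coeff: "Q * (\<theta>s i * \<mu> i) = \<theta>s i * \<mu> i + (Q - 1) * (c * (\<mu> i)\<^sup>2 + c')"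
      using assms[of i] by (simp add: algebra_simps)
    have "?f u = scale (Q * (\<theta>s i * \<mu> i)) u + scale (\<mu> (i - 1)) u'"
      using weight_step[of "i - 1"]
      by (simp add: K_U[OF u] As.scale Asu scale_right_distrib mult_ac)
    also have "\<dots> = ?g u"
      unfolding coeff
      by (simp add: K_U[OF u] K.add K.scale Asu Ku' scale_right_distrib scale_left_distrib power2_eq_square algebra_simps)
    finally show "?f u = ?g u" .
  qed
  ultimately have "span (\<Union>i. U i) \<subseteq> {v. ?f v = ?g v}"
    by (rule span_minimal[rotated])
  then show ?thesis
    using span_U by blast
qed

end

section \<open>Flags spanned by initial or final segments of a family of subspaces\<close>

definition partial_span ::
  "('k::field \<Rightarrow> 'v::ab_group_add \<Rightarrow> 'v) \<Rightarrow> nat \<Rightarrow> (nat \<Rightarrow> 'v set) \<Rightarrow> (int \<Rightarrow> bool) \<Rightarrow> 'v set" where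
  "partial_span scale d V P = module.span scale (\<Union>h\<in>{h. h \<le> d \<and> P (int h)}. V h)"

context vector_space
begin

lemma subspace_partial_span: "subspace (partial_span scale d V P)"
  by (simp add: partial_span_def)

lemma partial_span_mono: "(\<And>h. P h \<Longrightarrow> P' h) \<Longrightarrow> partial_span scale d V P \<subseteq> partial_span scale d V P'"
  unfolding partial_span_def by (intro span_mono) auto

lemma partial_span_base: "h \<le> d \<Longrightarrow> P (int h) \<Longrightarrow> V h \<subseteq> partial_span scale d V P"
  unfolding partial_span_def by (auto intro: span_base)

lemma zero_ext_subset_partial_span: "P i \<Longrightarrow> zero_ext d V i \<subseteq> partial_span scale d V P"
  using partial_span_base[of "nat i" d P V] subspace_0[OF subspace_partial_span]
  by (auto simp: zero_ext_def nat_le_iff)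

lemma tridiagonal_partial_span:
  assumes "Vector_Spaces.linear scale scale T"
    and tri: "\<And>i. i \<le> d \<Longrightarrow> T ` V i \<subseteq> zero_ext d V (int i - 1) + V i + zero_ext d V (int i + 1)"
    and P: "\<And>i. P i \<Longrightarrow> P' (i - 1) \<and> P' i \<and> P' (i + 1)"
    and v: "v \<in> partial_span scale d V P"
  shows "T v \<in> partial_span scale d V P'"
proof (rule linear_image_span_subset[OF assms(1) subspace_partial_span _ v[unfolded partial_span_def]])
  fix x assume "x \<in> (\<Union>h\<in>{h. h \<le> d \<and> P (int h)}. V h)"
  then obtain h where h: "h \<le> d" "P (int h)" "x \<in> V h" by blast
  have "zero_ext d V (int h - 1) + V h + zero_ext d V (int h + 1) \<subseteq> partial_span scale d V P'"
    using P[OF h(2)] h(1)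
    by (intro subspace_set_plus_least subspace_partial_span zero_ext_subset_partial_span partial_span_base) auto
  then show "T x \<in> partial_span scale d V P'"
    using tri[OF h(1)] h(3) by blast
qed

text \<open>\<open>T - \<theta> i\<close> annihilates \<open>V i\<close> and preserves every other
  \<open>V h\<close>, so it removes the end index \<open>i\<close> of a segment.\<close>

lemma eigen_partial_span:
  assumes "Vector_Spaces.linear scale scale T"
    and eig: "\<And>h x. h \<le> d \<Longrightarrow> x \<in> V h \<Longrightarrow> T x = scale (\<theta> (int h)) x"
    and P: "\<And>h. P h \<Longrightarrow> h = i \<or> P' h"
    and v: "v \<in> partial_span scale d V P"
  shows "T v - scale (\<theta> i) v \<in> partial_span scale d V P'"
proof (rule linear_image_span_subset[OF linear_shift[OF assms(1)] subspace_partial_span _ v[unfolded partial_span_def]])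
  fix x assume "x \<in> (\<Union>h\<in>{h. h \<le> d \<and> P (int h)}. V h)"
  then obtain h where h: "h \<le> d" "P (int h)" "x \<in> V h" by blast
  show "T x - scale (\<theta> i) x \<in> partial_span scale d V P'"
  proof (cases "int h = i")
    case True
    then show ?thesis using eig[OF h(1,3)] subspace_0[OF subspace_partial_span] by simp
  next
    case False
    then have "x \<in> partial_span scale d V P'"
      using P[OF h(2)] partial_span_base[of h d P' V] h by blast
    then show ?thesis
      using eig[OF h(1,3)] by (auto intro: subspace_diff subspace_scale subspace_partial_span)
  qed
qed

text \<open>The family \<open>V\<close> is arbitrary, so that listing the eigenspaces of
  \<open>A\<close> forwards or backwards yields the two split decompositions. Conditions on integer
  indices make the flags zero or full beyond the ends.\<close>

lemma split_flags_partial_span: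
  assumes A: "Vector_Spaces.linear scale scale A" and As: "Vector_Spaces.linear scale scale As"
    and irreducible: "\<And>W. \<lbrakk>subspace W; A ` W \<subseteq> W; As ` W \<subseteq> W\<rbrakk> \<Longrightarrow> W = {0} \<or> W = UNIV"
    and tri_A: "\<And>i. i \<le> d \<Longrightarrow> A ` Vs i \<subseteq> zero_ext d Vs (int i - 1) + Vs i + zero_ext d Vs (int i + 1)"
    and tri_As: "\<And>i. i \<le> d \<Longrightarrow> As ` V i \<subseteq> zero_ext d V (int i - 1) + V i + zero_ext d V (int i + 1)"
    and eig_A: "\<And>i v. i \<le> d \<Longrightarrow> v \<in> V i \<Longrightarrow> A v = scale (\<theta> (int i)) v"
    and eig_As: "\<And>i v. i \<le> d \<Longrightarrow> v \<in> Vs i \<Longrightarrow> As v = scale (\<theta>s (int i)) v"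
    and span_V: "span (\<Union>h\<in>{..d}. V h) = UNIV" and span_Vs: "span (\<Union>h\<in>{..d}. Vs h) = UNIV"
    and below: "span (\<Union>h\<in>{..<d}. Vs h) \<noteq> UNIV" and nonzero: "\<not> Vs 0 \<subseteq> {0}"
  shows "split_flags scale A As d (\<lambda>i. partial_span scale d Vs (\<lambda>h. h \<le> i)) (\<lambda>i. partial_span scale d V (\<lambda>h. i \<le> h)) \<theta> \<theta>s"
proof -
  interpret A: Vector_Spaces.linear scale scale A by fact
  interpret As: Vector_Spaces.linear scale scale As by fact
  show ?thesis
  proof unfold_locales
    show "partial_span scale d Vs (\<lambda>h. h \<le> i) = {0}" if "i < 0" for i
      using that by (simp add: partial_span_def)
    show "partial_span scale d V (\<lambda>h. i \<le> h) = {0}" if "int d < i" for i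
    proof -
      have empty: "{h. h \<le> d \<and> i \<le> int h} = {}" using that by auto
      show ?thesis unfolding partial_span_def empty by simp
    qed
    show "partial_span scale d Vs (\<lambda>h. h \<le> 0) \<noteq> {0}"
      using nonzero partial_span_base[of 0 d "\<lambda>h. h \<le> 0" Vs] by auto
    show "partial_span scale d Vs (\<lambda>h. h \<le> int d) = UNIV" "partial_span scale d V (\<lambda>h. 0 \<le> h) = UNIV"
      using span_V span_Vs by (simp_all add: partial_span_def atMost_def)
    have "{h. h \<le> d \<and> int h \<le> int d - 1} = {..<d}" by auto
    then show "partial_span scale d Vs (\<lambda>h. h \<le> int d - 1) \<noteq> UNIV"
      using below by (simp add: partial_span_def)
    show "A v - scale (\<theta> i) v \<in> partial_span scale d V (\<lambda>h. i + 1 \<le> h)" if "v \<in> partial_span scale d V (\<lambda>h. i \<le> h)" for i v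
      by (rule eigen_partial_span[where \<theta> = \<theta> and i = i, OF A eig_A _ that]) auto
    show "As v - scale (\<theta>s i) v \<in> partial_span scale d Vs (\<lambda>h. h \<le> i - 1)" if "v \<in> partial_span scale d Vs (\<lambda>h. h \<le> i)" for i v
      by (rule eigen_partial_span[where \<theta> = \<theta>s and i = i, OF As eig_As _ that]) auto
    show "A v \<in> partial_span scale d Vs (\<lambda>h. h \<le> i + 1)" if "v \<in> partial_span scale d Vs (\<lambda>h. h \<le> i)" for i v
      by (rule tridiagonal_partial_span[OF A tri_A _ that]) auto
    show "As v \<in> partial_span scale d V (\<lambda>h. i - 1 \<le> h)" if "v \<in> partial_span scale d V (\<lambda>h. i \<le> h)" for i v
      by (rule tridiagonal_partial_span[OF As tri_As _ that]) auto
    show "partial_span scale d Vs (\<lambda>h. h \<le> i) \<subseteq> partial_span scale d Vs (\<lambda>h. h \<le> j)" if "i \<le> j" for i j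
      using that by (intro partial_span_mono) auto
    show "partial_span scale d V (\<lambda>h. j \<le> h) \<subseteq> partial_span scale d V (\<lambda>h. i \<le> h)" if "i \<le> j" for i j
      using that by (intro partial_span_mono) auto
    show "W = {0} \<or> W = UNIV" if "subspace W" "A ` W \<subseteq> W" "As ` W \<subseteq> W" for W
      using that by (rule irreducible)
  qed (simp_all add: A.add A.scale As.add As.scale subspace_partial_span)
qed

text \<open>A nonzero vector of \<open>W\<close> determines the scalar, which makes the definite
  description in \<open>eigenvalue_on\<close> meaningful.\<close>

lemma eigenvalue_on_eigenspace:
  assumes "W \<in> eigenspaces scale A" "subspace W"
  shows "W = eigenspace scale A (eigenvalue_on scale A W)"
proof -
  obtain \<theta> where W: "W = eigenspace scale A \<theta>" "W \<noteq> {0}"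
    using assms by (auto simp: eigenspaces_def)
  then obtain w where w: "w \<in> W" "w \<noteq> 0"
    using subspace_0[OF assms(2)] by blast
  have "eigenvalue_on scale A W = \<theta>"
    unfolding eigenvalue_on_def
  proof (rule the_equality)
    show "\<forall>w\<in>W. A w = scale \<theta> w" by (simp add: W(1) eigenspace_def)
    fix \<eta> assume "\<forall>w\<in>W. A w = scale \<eta> w"
    moreover have "A w = scale \<theta> w"
      using w W(1) by (simp add: eigenspace_def)
    ultimately show "\<eta> = \<theta>"
      using w by (metis scale_right_imp_eq)
  qed
  then show ?thesis using W by simp
qed

end

subsection \<open>Eigenspaces of the map M\<close>

text \<open>The commutation relation of \<open>K\<close> and \<open>M\<close> gives the first claim,
  with \<open>Q * \<mu> i = \<mu> (i - 1)\<close>. The third follows from the definition of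
  \<open>M\<close>, which determines \<open>B w\<close> by \<open>K w\<close> on an eigenvector; it
  reduces the statement for \<open>B\<close> to the one for \<open>K\<close>.\<close>

lemma M_eigenvector_lowering:
  fixes scale :: "'k::field \<Rightarrow> 'v::ab_group_add \<Rightarrow> 'v" and \<mu> :: "int \<Rightarrow> 'k" and i :: int
  assumes up: "split_weight_map scale A As d F G \<theta> \<theta>s K \<mu> Q"
    and down: "split_weight_map scale A As d F G' \<theta>' \<theta>s B \<mu> Q"
    and nz: "Q \<noteq> 0" "a \<noteq> 0" "a\<^sup>2 \<noteq> 1"
    and \<theta>: "\<And>i. \<theta> i * \<mu> i = a * (\<mu> i)\<^sup>2 + inverse a"
    and \<theta>': "\<And>i. \<theta>' i * \<mu> i = inverse a * (\<mu> i)\<^sup>2 + a"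
    and \<theta>s: "\<And>i. \<theta>s i * \<mu> i = b * (\<mu> i)\<^sup>2 + b'"
    and distinct: "\<And>i. 1 \<le> i \<Longrightarrow> i \<le> int d \<Longrightarrow> \<mu> i \<noteq> \<mu> 0"
    and w: "M_map scale a K B w = scale (\<mu> i) w"
  shows "M_map scale a K B (K w - scale (\<mu> i) w) = scale (\<mu> (i - 1)) (K w - scale (\<mu> i) w)"
    and "i = 0 \<Longrightarrow> K w = scale (\<mu> 0) w"
    and "B w - scale (\<mu> i) w = scale (a\<^sup>2) (K w - scale (\<mu> i) w)"
proof -
  interpret up: split_weight_map scale A As d F G \<theta> \<theta>s K \<mu> Q by (rule up)
  interpret down: split_weight_map scale A As d F G' \<theta>' \<theta>s B \<mu> Q by (rule down)
  have lin: "Vector_Spaces.linear scale scale K" "Vector_Spaces.linear scale scale B"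
    by unfold_locales
  interpret q_weyl_relations scale A As K B Q a b b'
    by (intro q_weyl_relations.intro q_weyl_relations_axioms.intro up.vector_space_axioms up.linear_A
        up.linear_As lin nz up.weight_relation_A[OF \<theta>] down.weight_relation_A[OF \<theta>']
        up.weight_relation_As[OF \<theta>s] down.weight_relation_As[OF \<theta>s])
  let ?M = "M_map scale a K B"
  have a_diff: "a - inverse a \<noteq> 0"
    using nz by (auto simp: field_simps power2_eq_square)
  \<comment> \<open>Since \<open>F (-1)\<close> is zero, triangularity makes both maps act on
    \<open>F 0\<close> as the same scalar. This is the invariant subspace from which
    \<open>X_eq_0\<close> starts.\<close>
  have K_F0: "K y = scale (\<mu> 0) y" and B_F0: "B y = scale (\<mu> 0) y" if "y \<in> F 0" for y
    using up.weight_lowers_F[OF that] down.weight_lowers_F[OF that] up.F_neg[of "-1"] by simp_all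
  have X: "X v = 0" for v
  proof (rule X_eq_0[OF up.irreducible up.subspace_F up.F_zero])
    show "X y = 0" if "y \<in> F 0" for y
    proof -
      \<comment> \<open>The four coefficients of \<open>X\<close> sum to zero.\<close>
      have "X y = scale ((a\<^sup>2 * (Q - 1) - (Q - a\<^sup>2) - (a\<^sup>2 * Q - 1) + (Q - 1)) * (\<mu> 0 * \<mu> 0)) y"
        unfolding X_def by (simp add: K_F0[OF that] B_F0[OF that] up.K.scale down.K.scale algebra_simps)
      then show ?thesis by (simp add: algebra_simps)
    qed
  qed (auto simp: K_F0 B_F0 intro: up.subspace_scale up.subspace_F)
  have MK: "?M (K w) = scale (Q * \<mu> i) (K w) - scale ((Q - 1) * (\<mu> i * \<mu> i)) w"
  proof -
    have "?M (scale c v) = scale c (?M v)" for c v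
      by (simp add: M_map_def up.K.scale down.K.scale up.scale_right_diff_distrib mult_ac)
    then show ?thesis
      using M_map_q_commutation[OF X, of w] by (simp add: w up.K.scale algebra_simps)
  qed
  have "?M (K w - scale (\<mu> i) w) = ?M (K w) - scale (\<mu> i) (?M w)"
    by (simp add: M_map_def up.K.scale down.K.scale up.K.diff down.K.diff algebra_simps)
  also have "\<dots> = scale (Q * \<mu> i) (K w - scale (\<mu> i) w)"
    unfolding MK w by (simp add: algebra_simps)
  also have "Q * \<mu> i = \<mu> (i - 1)"
    using up.weight_step[of "i - 1"] by simp
  finally show "?M (K w - scale (\<mu> i) w) = scale (\<mu> (i - 1)) (K w - scale (\<mu> i) w)" .

  have M_scaled: "scale (a - inverse a) (?M x) = scale a (K x) - scale (inverse a) (B x)" for x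
    using a_diff by (simp add: M_map_def)
  from this[of w] have "scale (inverse a) (B w) = scale a (K w) - scale ((a - inverse a) * \<mu> i) w"
    by (simp add: w algebra_simps)
  then have "scale a (scale (inverse a) (B w)) = scale a (scale a (K w) - scale ((a - inverse a) * \<mu> i) w)"
    by simp
  moreover have "a * ((a - inverse a) * \<mu> i) = a\<^sup>2 * \<mu> i - \<mu> i"
    using nz by (simp add: field_simps power2_eq_square)
  ultimately have "B w = scale (a\<^sup>2) (K w) - scale (a\<^sup>2 * \<mu> i - \<mu> i) w"
    using nz by (simp add: up.scale_right_diff_distrib power2_eq_square)
  then show "B w - scale (\<mu> i) w = scale (a\<^sup>2) (K w - scale (\<mu> i) w)"
    by (simp add: algebra_simps)

  \<comment> \<open>\<open>M\<close> is a combination of \<open>K\<close> and \<open>B\<close> whose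
    coefficients sum to one, so it inherits their triangularity and diagonal scalars.\<close>
  have M_F: "?M x - scale (\<mu> n) x \<in> F (n - 1)" if "x \<in> F n" for x n
  proof -
    have "scale (a - inverse a) (?M x - scale (\<mu> n) x)
        = scale a (K x - scale (\<mu> n) x) - scale (inverse a) (B x - scale (\<mu> n) x)"
      unfolding up.scale_right_diff_distrib M_scaled
      by (simp add: up.scale_left_diff_distrib del: up.scale_scale)
    also have "\<dots> \<in> F (n - 1)"
      using up.weight_lowers_F[OF that] down.weight_lowers_F[OF that]
      by (auto intro: up.subspace_diff up.subspace_scale up.subspace_F)
    finally have "scale (inverse (a - inverse a)) (scale (a - inverse a) (?M x - scale (\<mu> n) x)) \<in> F (n - 1)"
      by (rule up.subspace_scale[OF up.subspace_F])
    then show ?thesis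
      using a_diff by simp
  qed
  assume "i = 0"
  \<comment> \<open>Descent from \<open>F d\<close> to \<open>F 0\<close>: on \<open>w\<close> the
    map \<open>M - \<mu> n\<close> is the scalar \<open>\<mu> 0 - \<mu> n\<close>, nonzero for
    \<open>n\<close> from 1 to \<open>d\<close>, and it sends \<open>F n\<close> into
    \<open>F (n - 1)\<close>.\<close>
  have "w \<in> F (int n) \<Longrightarrow> n \<le> d \<Longrightarrow> w \<in> F 0" for n
  proof (induction n)
    case (Suc n)
    have "scale (\<mu> 0 - \<mu> (int (Suc n))) w \<in> F (int n)"
      using M_F[OF Suc.prems(1)] by (simp add: w \<open>i = 0\<close> up.scale_left_diff_distrib)
    then have "scale (inverse (\<mu> 0 - \<mu> (int (Suc n)))) (scale (\<mu> 0 - \<mu> (int (Suc n))) w) \<in> F (int n)"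
      by (rule up.subspace_scale[OF up.subspace_F])
    then have "w \<in> F (int n)"
      using distinct[of "int (Suc n)"] Suc.prems(2) by simp
    then show ?case using Suc by simp
  qed simp
  then have "w \<in> F 0"
    using up.F_top by auto
  then show "K w = scale (\<mu> 0) w" by (rule K_F0)
qed

section \<open>Application to TD systems of q-Racah type\<close>

theorem lemma9p2:
  fixes scale :: "'k::alg_closed_field \<Rightarrow> 'v::ab_group_add \<Rightarrow> 'v"
    and Basis :: "'v set"
    and A As K B :: "'v \<Rightarrow> 'v"
    and E Es :: "nat \<Rightarrow> 'v \<Rightarrow> 'v"
    and q a b :: 'k
    and d i :: nat
  assumes "finite_dimensional_vector_space scale Basis"
    and "vector_space.dim scale (UNIV :: 'v set) > 0"
    and "d \<ge> 1"
    and "TD_system scale d A E As Es"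
    and "q_Racah_type scale d A E As Es q a b"
    and "weight_map scale q d (split_U d E Es) K"
    and "weight_map scale q d (split_U_down d E Es) B"
    and "i \<le> d"
  shows "(\<lambda>v. K v - scale (q powi (int d - 2 * int i)) v) ` W_space scale d q a K B (int i)
           \<subseteq> W_space scale d q a K B (int i - 1)
       \<and> (\<lambda>v. B v - scale (q powi (int d - 2 * int i)) v) ` W_space scale d q a K B (int i)
           \<subseteq> W_space scale d q a K B (int i - 1)"
proof -
  interpret finite_dimensional_vector_space scale Basis by fact
  define \<mu> where "\<mu> j = q powi (int d - 2 * j)" for j :: int
  define \<theta> where "\<theta> j = a * \<mu> j + inverse a * q powi (2 * j - int d)" for j
  \<comment> \<open>This is \<open>\<theta> (d - j)\<close>: reversing the eigenvalues of
    \<open>A\<close> exchanges \<open>a\<close> and \<open>inverse a\<close>.\<close>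
  define \<theta>' where "\<theta>' j = a * q powi (2 * j - int d) + inverse a * \<mu> j" for j
  define \<theta>s where "\<theta>s j = b * \<mu> j + inverse b * q powi (2 * j - int d)" for j
  define V where "V h = range (E h)" for h
  define Vs where "Vs h = range (Es h)" for h
  have td: "TD_pair scale A As"
    and idem: "\<And>h. h \<le> d \<Longrightarrow> primitive_idempotent scale A (V h) (E h)"
      "\<And>h. h \<le> d \<Longrightarrow> primitive_idempotent scale As (Vs h) (Es h)"
    and ord: "standard_ordering scale A As d V" "standard_ordering scale As A d Vs"
    using assms(4) by (auto simp: TD_system_def V_def[abs_def] Vs_def[abs_def])
  have bij: "bij_betw V {0..d} (eigenspaces scale A)" "bij_betw Vs {0..d} (eigenspaces scale As)"
    using ord by (simp_all add: standard_ordering_def)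
  have lin: "Vector_Spaces.linear scale scale A" "Vector_Spaces.linear scale scale As"
    and diag: "span (\<Union>(eigenspaces scale A)) = UNIV" "span (\<Union>(eigenspaces scale As)) = UNIV"
    and irreducible: "\<And>W. \<lbrakk>subspace W; A ` W \<subseteq> W; As ` W \<subseteq> W\<rbrakk> \<Longrightarrow> W = {0} \<or> W = UNIV"
    using td unfolding TD_pair_def diagonalizable_def by blast+
  have q: "q \<noteq> 0" "a \<noteq> 0" "b \<noteq> 0"
    and ev: "\<And>h. h \<le> d \<Longrightarrow> eigenvalue_on scale A (V h) = \<theta> (int h)"
      "\<And>h. h \<le> d \<Longrightarrow> eigenvalue_on scale As (Vs h) = \<theta>s (int h)"
    using assms(5) by (simp_all add: q_Racah_type_def \<theta>_def \<theta>s_def \<mu>_def V_def Vs_def)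
  have mem: "V h \<in> eigenspaces scale A" "Vs h \<in> eigenspaces scale As" if "h \<le> d" for h
    using bij that by (auto dest: bij_betwE)
  have linE: "Vector_Spaces.linear scale scale (E h)" "Vector_Spaces.linear scale scale (Es h)" if "h \<le> d" for h
    using idem that by (simp_all add: primitive_idempotent_def)
  have subspaces: "subspace (V h)" "subspace (Vs h)" if "h \<le> d" for h
    using linE[OF that] module_hom.subspace_image[OF _ subspace_UNIV]
    by (simp_all add: V_def Vs_def linear_iff_module_hom)
  have V_eq: "V h = eigenspace scale A (\<theta> (int h))" and Vs_eq: "Vs h = eigenspace scale As (\<theta>s (int h))"
    if "h \<le> d" for h
    using eigenvalue_on_eigenspace mem[OF that] subspaces[OF that] ev[OF that] by metis+
  have eig: "\<And>h v. h \<le> d \<Longrightarrow> v \<in> V h \<Longrightarrow> A v = scale (\<theta> (int h)) v"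
    "\<And>h v. h \<le> d \<Longrightarrow> v \<in> Vs h \<Longrightarrow> As v = scale (\<theta>s (int h)) v"
    using V_eq Vs_eq by (auto simp: eigenspace_def)
  \<comment> \<open>\<open>V h\<close> is determined by its eigenvalue, and the ordering lists no
    eigenspace twice.\<close>
  have \<theta>_inj: "h = j" if "h \<le> d" "j \<le> d" "\<theta> (int h) = \<theta> (int j)" for h j
    using that V_eq bij(1) by (metis atLeastAtMost_iff bij_betw_def inj_on_def le0)
  have spans: "span (\<Union>h\<in>{..d}. V h) = UNIV" "span (\<Union>h\<in>{..d}. Vs h) = UNIV"
    using diag bij by (simp_all add: bij_betw_def atLeast0AtMost)
  have nontrivial: "\<not> Vs h \<subseteq> {0}" if "h \<le> d" for h
    using mem(2)[OF that] subspace_0[OF subspaces(2)[OF that]] by (auto simp: eigenspaces_def)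
  \<comment> \<open>\<open>Es d\<close> vanishes on every \<open>Vs h\<close> with
    \<open>h < d\<close>. If these spanned the space, \<open>Es d\<close> would be zero, although
    its range is a nonzero eigenspace.\<close>
  have below: "span (\<Union>h\<in>{..<d}. Vs h) \<noteq> UNIV"
  proof
    assume full: "span (\<Union>h\<in>{..<d}. Vs h) = UNIV"
    have "Es d v \<in> {0}" for v
    proof (rule linear_image_span_subset[OF linE(2)])
      show "v \<in> span (\<Union>h\<in>{..<d}. Vs h)" using full by simp
      fix x assume "x \<in> (\<Union>h\<in>{..<d}. Vs h)"
      then obtain h where h: "h < d" "x \<in> Vs h" by blast
      then have "Vs h \<noteq> Vs d"
        using bij(2) unfolding bij_betw_def inj_on_def by (metis atLeastAtMost_iff le0 less_imp_le nat_less_le order_refl)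
      then show "Es d x \<in> {0}"
        using idem(2)[of d] mem(2)[of h] h by (auto simp: primitive_idempotent_def)
    qed auto
    then show False using nontrivial[of d] by (auto simp: Vs_def)
  qed
  have tri: "\<And>h. h \<le> d \<Longrightarrow> A ` Vs h \<subseteq> zero_ext d Vs (int h - 1) + Vs h + zero_ext d Vs (int h + 1)"
    "\<And>h. h \<le> d \<Longrightarrow> As ` V h \<subseteq> zero_ext d V (int h - 1) + V h + zero_ext d V (int h + 1)"
    using ord by (auto simp: standard_ordering_def)
  let ?F = "\<lambda>i. partial_span scale d Vs (\<lambda>h. h \<le> i)"
  let ?G = "\<lambda>i. partial_span scale d V (\<lambda>h. i \<le> h)"
  \<comment> \<open>In the reversed listing the initial sums of \<open>split_U_down\<close> become
    final segments, so the same locale applies.\<close>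
  let ?V' = "\<lambda>h. V (d - h)"
  let ?G' = "\<lambda>i. partial_span scale d ?V' (\<lambda>h. i \<le> h)"
  interpret up: split_flags scale A As d ?F ?G \<theta> \<theta>s
    by (rule split_flags_partial_span[where V = V and \<theta> = \<theta> and \<theta>s = \<theta>s, OF lin irreducible tri eig spans below nontrivial]) auto
  have tri': "As ` ?V' h \<subseteq> zero_ext d ?V' (int h - 1) + ?V' h + zero_ext d ?V' (int h + 1)" if "h \<le> d" for h
  proof -
    have "zero_ext d ?V' (int h - 1) = zero_ext d V (int (d - h) + 1)"
      "zero_ext d ?V' (int h + 1) = zero_ext d V (int (d - h) - 1)"
      using that by (auto simp: zero_ext_def of_nat_diff nat_diff_distrib intro!: arg_cong[where f = V])
    then show ?thesis
      using tri(2)[of "d - h"] by (simp add: add_ac)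
  qed
  have eig': "A v = scale (\<theta>' (int h)) v" if "h \<le> d" "v \<in> ?V' h" for h v
    using eig(1)[of "d - h" v] that by (simp add: \<theta>_def \<theta>'_def \<mu>_def of_nat_diff algebra_simps)
  have span_V': "span (\<Union>h\<in>{..d}. ?V' h) = UNIV"
  proof -
    have "(\<Union>h\<in>{..d}. ?V' h) = (\<Union>h\<in>{..d}. V h)"
    proof safe
      fix x h assume "x \<in> V h" "h \<le> d"
      then show "x \<in> (\<Union>h\<in>{..d}. ?V' h)"
        by (intro UN_I[of "d - h"]) auto
    qed auto
    then show ?thesis using spans by simp
  qed
  interpret down: split_flags scale A As d ?F ?G' \<theta>' \<theta>s
    by (rule split_flags_partial_span[where V = ?V' and \<theta> = \<theta>' and \<theta>s = \<theta>s,
          OF lin irreducible tri(1) tri' eig' eig(2) span_V' spans(2) below nontrivial]) auto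

  have weights: "q\<^sup>2 * \<mu> (j + 1) = \<mu> j" for j
    using q by (simp add: \<mu>_def power_int_diff power_int_add field_simps power2_eq_square)
  have F_eq: "?F (int h) = (\<Sum>j\<in>{0..h}. range (Es j))" if "h \<le> d" for h
  proof -
    have "{j. j \<le> d \<and> int j \<le> int h} = {0..h}" using that by auto
    then show ?thesis
      using that subspaces by (subst set_sum_eq_span) (auto simp: partial_span_def Vs_def)
  qed
  have G_eq: "?G (int h) = (\<Sum>j\<in>{h..d}. range (E j))" for h
  proof -
    have "{j. j \<le> d \<and> int h \<le> int j} = {h..d}" by auto
    then show ?thesis
      using subspaces by (subst set_sum_eq_span) (auto simp: partial_span_def V_def)
  qed
  have G'_eq: "?G' (int h) = (\<Sum>j\<in>{0..d-h}. range (E j))" if "h \<le> d" for h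
  proof -
    have "(\<Union>j\<in>{j. j \<le> d \<and> int h \<le> int j}. ?V' j) = (\<Union>j\<in>{0..d-h}. V j)"
    proof safe
      fix x j assume "x \<in> V j" "j \<in> {0..d-h}"
      then show "x \<in> (\<Union>j\<in>{j. j \<le> d \<and> int h \<le> int j}. ?V' j)"
        using that by (intro UN_I[of "d - j"]) auto
    qed auto
    then show ?thesis
      using subspaces that by (subst set_sum_eq_span) (auto simp: partial_span_def V_def)
  qed
  \<comment> \<open>Outside \<open>0..d\<close> the space \<open>U j\<close> is zero, so the locale
    assumption for all integers costs nothing.\<close>
  have K: "K u = scale (\<mu> j) u" if "u \<in> up.U j" for j u
  proof (cases "0 \<le> j \<and> j \<le> int d")
    case True
    then obtain n where "j = int n" "n \<le> d" by (metis nonneg_int_cases of_nat_le_iff)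
    then show ?thesis
      using assms(6) that by (auto simp: weight_map_def split_U_def up.U_def F_eq G_eq \<mu>_def)
  next
    case False
    then show ?thesis
      using that up.U_outside[of j] module_hom.zero[of scale scale K] assms(6)
      by (auto simp: weight_map_def linear_iff_module_hom)
  qed
  have B: "B u = scale (\<mu> j) u" if "u \<in> down.U j" for j u
  proof (cases "0 \<le> j \<and> j \<le> int d")
    case True
    then obtain n where "j = int n" "n \<le> d" by (metis nonneg_int_cases of_nat_le_iff)
    then show ?thesis
      using assms(7) that by (auto simp: weight_map_def split_U_down_def down.U_def F_eq G'_eq \<mu>_def)
  next
    case False
    then show ?thesis
      using that down.U_outside[of j] module_hom.zero[of scale scale B] assms(7)
      by (auto simp: weight_map_def linear_iff_module_hom)
  qed
  have up: "split_weight_map scale A As d ?F ?G \<theta> \<theta>s K \<mu> (q\<^sup>2)"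
    using assms(6) by (intro split_weight_map.intro split_weight_map_axioms.intro up.split_flags_axioms K weights)
      (simp add: weight_map_def)
  have down: "split_weight_map scale A As d ?F ?G' \<theta>' \<theta>s B \<mu> (q\<^sup>2)"
    using assms(7) by (intro split_weight_map.intro split_weight_map_axioms.intro down.split_flags_axioms B weights)
      (simp add: weight_map_def)
  have inv: "q powi (2 * j - int d) * \<mu> j = 1" for j
    using q by (simp add: \<mu>_def flip: power_int_add)
  \<comment> \<open>Otherwise \<open>\<theta>\<close> would be symmetric under reversal and take the
    same value at \<open>0\<close> and \<open>d\<close>, which differ as
    \<open>d \<ge> 1\<close>.\<close>
  have a_square: "a\<^sup>2 \<noteq> 1"
  proof
    assume "a\<^sup>2 = 1"
    then have "inverse a = a"
      using q by (simp add: field_simps power2_eq_square)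
    then have "\<theta> (int 0) = \<theta> (int d)"
      by (simp add: \<theta>_def \<mu>_def)
    then show False using \<theta>_inj[of 0 d] assms(3) by simp
  qed
  \<comment> \<open>\<open>\<theta> j\<close> is a function of \<open>\<mu> j\<close>, so distinct
    eigenvalues force distinct weights.\<close>
  have distinct: "\<mu> j \<noteq> \<mu> 0" if "1 \<le> j" "j \<le> int d" for j
  proof
    assume eq: "\<mu> j = \<mu> 0"
    have "q powi (2 * k - int d) = inverse (\<mu> k)" for k
      using inv[of k] by (metis inverse_unique mult.commute)
    then have "\<theta> j = \<theta> 0"
      by (simp only: \<theta>_def eq)
    then show False
      using \<theta>_inj[of "nat j" 0] that by (simp add: nat_le_iff)
  qed
  have scalars: "\<theta> j * \<mu> j = a * (\<mu> j)\<^sup>2 + inverse a" "\<theta>' j * \<mu> j = inverse a * (\<mu> j)\<^sup>2 + a"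
    "\<theta>s j * \<mu> j = b * (\<mu> j)\<^sup>2 + inverse b" for j
    using inv[of j] by (simp_all add: \<theta>_def \<theta>'_def \<theta>s_def algebra_simps power2_eq_square)
  note lowering = M_eigenvector_lowering[OF up down _ q(2) a_square scalars distinct]
  let ?M = "M_map scale a K B"
  have main: "K w - scale (\<mu> (int i)) w \<in> W_space scale d q a K B (int i - 1)
      \<and> B w - scale (\<mu> (int i)) w \<in> W_space scale d q a K B (int i - 1)"
    if "w \<in> W_space scale d q a K B (int i)" for w
  proof -
    let ?x = "K w - scale (\<mu> (int i)) w"
    have w: "?M w = scale (\<mu> (int i)) w"
      using that assms(8) by (simp add: W_space_def zero_ext_def eigenspace_def \<mu>_def)
    have B_eq: "B w - scale (\<mu> (int i)) w = scale (a\<^sup>2) ?x"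
      using lowering(3)[OF _ _ _ w] q by simp
    show ?thesis
    proof (cases "i = 0")
      case True
      \<comment> \<open>As \<open>W_space\<close> at \<open>-1\<close> is zero by convention, being
        an eigenvector for \<open>\<mu> (-1)\<close> would not suffice here.\<close>
      then have "?x = 0"
        using lowering(2)[OF _ _ _ w] q by simp
      then show ?thesis
        using True B_eq by (simp add: W_space_def zero_ext_def)
    next
      case False
      have Mx: "?M ?x = scale (\<mu> (int i - 1)) ?x"
        using lowering(1)[OF _ _ _ w] q by simp
      interpret K: Vector_Spaces.linear scale scale K using assms(6) by (simp add: weight_map_def)
      interpret B: Vector_Spaces.linear scale scale B using assms(7) by (simp add: weight_map_def)
      have "?M (scale c v) = scale c (?M v)" for c v
        by (simp add: M_map_def K.scale B.scale scale_right_diff_distrib mult_ac)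
      then have "?M (scale c ?x) = scale (\<mu> (int i - 1)) (scale c ?x)" for c
        by (simp add: Mx mult.commute)
      then have "scale c ?x \<in> W_space scale d q a K B (int i - 1)" for c
        using False assms(8) by (simp add: W_space_def zero_ext_def eigenspace_def \<mu>_def of_nat_diff)
      \<comment> \<open>The factor 1 gives the claim for \<open>K\<close>, the factor
        \<open>a\<^sup>2\<close> the one for \<open>B\<close>.\<close>
      from this[of 1] this[of "a\<^sup>2"] show ?thesis
        by (simp add: B_eq)
    qed
  qed
  then show ?thesis
    unfolding \<mu>_def by blast
qed

end
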